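(* $p(Q_4 \setminus v) = 5$.
   Context: For $n\ge 1$, $Q_n$ is the $n$-dimensional hypercube: the graph with vertex set $\{0,1\}^n$ and edges between vertices differing in exactly one coordinate. $Q_4\setminus v$ denotes the graph obtained from $Q_4$ by deleting one vertex together with its incident edges; by symmetry it does not depend, up to isomorphism, on the choice. An embedding of a graph $G$ in $Q_n$ is any subgraph of $Q_n$ isomorphic to $G$. Given a set of $r$ colors, a $G$-polychromatic $r$-coloring of $Q_n$ is an assignment of one of the $r$ colors to each edge of $Q_n$ such that every embedding of $G$ in $Q_n$ contains an edge of every one of the $r$ colors. The polychromatic number $p(G)$ is the largest integer $r$ such that for every $n$ for which $Q_n$ contains an embedding of $G$, there is a $G$-polychromatic $r$-coloring of $Q_n$. *)

theory Defs
  imports "HOL-Library.FuncSet"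
begin

record 'a ugraph =
  verts :: "'a set"
  edges :: "'a set set"

definition simple_graph :: "'a ugraph \<Rightarrow> bool" where
  "simple_graph G \<longleftrightarrow> (\<forall>e\<in>edges G. e \<subseteq> verts G \<and> card e = 2)"

definition subgraph :: "'a ugraph \<Rightarrow> 'a ugraph \<Rightarrow> bool" where
  "subgraph H G \<longleftrightarrow> simple_graph H \<and> verts H \<subseteq> verts G \<and> edges H \<subseteq> edges G"

definition isomorphic :: "'a ugraph \<Rightarrow> 'b ugraph \<Rightarrow> bool" where
  "isomorphic G H \<longleftrightarrow>
     (\<exists>f. bij_betw f (verts G) (verts H) \<and>
          (\<forall>u\<in>verts G. \<forall>v\<in>verts G. {u, v} \<in> edges G \<longleftrightarrow> {f u, f v} \<in> edges H))"

definition delete_vertex :: "'a ugraph \<Rightarrow> 'a \<Rightarrow> 'a ugraph" where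
  "delete_vertex G v = \<lparr>verts = verts G - {v}, edges = {e \<in> edges G. v \<notin> e}\<rparr>"

definition hypercube :: "nat \<Rightarrow> bool list ugraph" where
  "hypercube n =
     \<lparr>verts = {x. length x = n},
      edges = {{x, y} | x y. length x = n \<and> length y = n \<and>
                             card {i. i < n \<and> x ! i \<noteq> y ! i} = 1}\<rparr>"

definition embedding :: "'a ugraph \<Rightarrow> nat \<Rightarrow> bool list ugraph \<Rightarrow> bool" where
  "embedding G n H \<longleftrightarrow> subgraph H (hypercube n) \<and> isomorphic G H"

text \<open>The set of \<open>r\<close> colors is \<open>{..<r}\<close>; values of \<open>c\<close> off the edge set are irrelevant.\<close>

definition polychromatic_coloring ::
    "'a ugraph \<Rightarrow> nat \<Rightarrow> nat \<Rightarrow> (bool list set \<Rightarrow> nat) \<Rightarrow> bool" where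
  "polychromatic_coloring G r n c \<longleftrightarrow>
     c \<in> edges (hypercube n) \<rightarrow> {..<r} \<and>
     (\<forall>H. embedding G n H \<longrightarrow> (\<forall>k<r. \<exists>e\<in>edges H. c e = k))"

definition polychromatic_colorable :: "'a ugraph \<Rightarrow> nat \<Rightarrow> bool" where
  "polychromatic_colorable G r \<longleftrightarrow>
     (\<forall>n\<ge>1. (\<exists>H. embedding G n H) \<longrightarrow> (\<exists>c. polychromatic_coloring G r n c))"

text \<open>If \<open>G\<close> embeds in no hypercube, every \<open>r\<close> qualifies and the value is unspecified.
  If a simple graph \<open>G\<close> has an edge and embeds in some hypercube, then \<open>1\<close> qualifies and the
  number of edges of \<open>G\<close> bounds every \<open>r\<close>, so the maximum exists.\<close>

definition polychromatic_number :: "'a ugraph \<Rightarrow> nat" where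
  "polychromatic_number G = (GREATEST r. polychromatic_colorable G r)"

end

theory Submission
  imports Defs "HOL-Library.Ramsey"
begin

text \<open>
  An embedded punctured \<open>Q\<^sub>4\<close> is always a four-dimensional subcube minus a vertex.

  Five colours: colour an edge by (ones left of the flipped coordinate) \<open>+ 2 *\<close> (ones right of it)
  modulo 5. In a subcube, the edges in one of the two middle directions see every residue, even after
  a vertex has been deleted.

  Not six: by Ramsey's theorem some subcube of large dimension is coloured according to the numbers
  \<open>a\<close>, \<open>b\<close> of ones left and right of the flipped coordinate. A four-dimensional subcube punctured at
  its bottom sees four rectangles of the \<open>(a, b)\<close>-grid with 3, 5, 5 and 3 cells left, whose positions
  can be chosen independently as long as they are nondecreasing in \<open>a\<close>. Hence for every colour the
  positions split into four runs, on each of which one of the shapes always meets the colour, and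
  this forces density at least 1/5.
\<close>

subsection \<open>Punctured cubes inside hypercubes\<close>

text \<open>Vertices are handled as sets of coordinates: adjacency becomes a one-element symmetric
  difference, and translating a cube becomes taking the symmetric difference with a fixed set. In
  \<open>cube_edge n X q\<close> with \<open>q\<close> outside \<open>X\<close>, the set
  \<open>X\<close> is the lower end and \<open>q\<close> the flipped coordinate.\<close>

definition support :: "bool list \<Rightarrow> nat set" where
  "support x = {i. i < length x \<and> x ! i}"

definition bits :: "nat \<Rightarrow> nat set \<Rightarrow> bool list" where
  "bits n X = map (\<lambda>i. i \<in> X) [0..<n]"

definition cube_edge :: "nat \<Rightarrow> nat set \<Rightarrow> nat \<Rightarrow> bool list set" where
  "cube_edge n X q = {bits n X, bits n (insert q X)}"

lemma length_bits [simp]: "length (bits n X) = n"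
  by (simp add: bits_def)

lemma nth_bits [simp]: "i < n \<Longrightarrow> bits n X ! i \<longleftrightarrow> i \<in> X"
  by (simp add: bits_def)

lemma support_bits: "support (bits n X) = X \<inter> {..<n}"
  by (auto simp: support_def)

lemma support_subset: "support x \<subseteq> {..<length x}"
  by (auto simp: support_def)

lemma bits_support: "bits (length x) (support x) = x"
  by (auto simp: support_def intro!: nth_equalityI)

lemma bits_eq_iff: "X \<subseteq> {..<n} \<Longrightarrow> Y \<subseteq> {..<n} \<Longrightarrow> bits n X = bits n Y \<longleftrightarrow> X = Y"
  by (metis support_bits inf.absorb1)

text \<open>The comprehension in \<open>hypercube\<close> may name the ends in either order; the
  condition on them is symmetric, so the order does not matter.\<close>

lemma doubleton_edge_hypercube:
  "{x, y} \<in> edges (hypercube n) \<longleftrightarrow>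
    length x = n \<and> length y = n \<and> card {i. i < n \<and> x ! i \<noteq> y ! i} = 1"
  (is "?L \<longleftrightarrow> ?R x y")
proof
  assume ?L
  then obtain x' y' where xy': "{x, y} = {x', y'}" "?R x' y'"
    unfolding hypercube_def ugraph.select_convs mem_Collect_eq by blast
  have "{i. i < n \<and> y' ! i \<noteq> x' ! i} = {i. i < n \<and> x' ! i \<noteq> y' ! i}" by blast
  then have "?R y' x'" using xy'(2) by simp
  moreover have "x = x' \<and> y = y' \<or> x = y' \<and> y = x'"
    using xy'(1) by (simp only: doubleton_eq_iff)
  ultimately show "?R x y" using xy'(2) by (elim disjE conjE) (simp_all only: simp_thms)
next
  assume "?R x y"
  then show ?L unfolding hypercube_def ugraph.select_convs mem_Collect_eq by blast
qed

lemma bits_adjacent_iff: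
  assumes "X \<subseteq> {..<n}" "Y \<subseteq> {..<n}"
  shows "{bits n X, bits n Y} \<in> edges (hypercube n) \<longleftrightarrow> (\<exists>q. sym_diff X Y = {q})"
proof -
  have "{i. i < n \<and> bits n X ! i \<noteq> bits n Y ! i} = sym_diff X Y"
    using assms by auto
  then show ?thesis
    by (simp only: doubleton_edge_hypercube length_bits One_nat_def card_1_singleton_iff simp_thms)
qed

section \<open>Edges and common neighbours through symmetric differences\<close>

lemma sym_diff_cancel: "sym_diff A B = C \<Longrightarrow> B = sym_diff A C"
  by auto

lemma sym_diff_assoc: "sym_diff (sym_diff A B) C = sym_diff A (sym_diff B C)"
  by auto

lemma sym_diff_insert_right:
  "a \<notin> B \<Longrightarrow> sym_diff A (insert a B) = sym_diff (sym_diff A B) {a}"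
  by auto

lemma sym_diff_singleton:
  assumes "sym_diff X Y = {q}"
  shows "Y = insert q X \<and> q \<notin> X \<or> X = insert q Y \<and> q \<notin> Y"
proof -
  have *: "x \<in> X \<longleftrightarrow> (x \<in> Y \<longleftrightarrow> x \<noteq> q)" for x
    using eqset_imp_iff[OF assms, of x] unfolding Un_iff Diff_iff singleton_iff by argo
  show ?thesis
  proof (cases "q \<in> Y")
    case True
    have "x \<in> Y \<longleftrightarrow> x \<in> insert q X" for x using True *[of x] by (cases "x = q") simp_all
    then have "Y = insert q X" by (rule set_eqI)
    moreover have "q \<notin> X" using True *[of q] by simp
    ultimately show ?thesis by (intro disjI1 conjI)
  next
    case False
    have "x \<in> X \<longleftrightarrow> x \<in> insert q Y" for x using False *[of x] by (cases "x = q") simp_all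
    then have "X = insert q Y" by (rule set_eqI)
    then show ?thesis using False by (intro disjI2 conjI)
  qed
qed

lemma edges_hypercube:
  "edges (hypercube n) = {cube_edge n X q | X q. X \<subseteq> {..<n} \<and> q < n \<and> q \<notin> X}"
proof (intro equalityI subsetI)
  fix e assume e: "e \<in> edges (hypercube n)"
  then obtain x y where xy: "e = {x, y}" "length x = n" "length y = n"
    by (auto simp: hypercube_def)
  let ?X = "support x" and ?Y = "support y"
  have sub: "?X \<subseteq> {..<n}" "?Y \<subseteq> {..<n}"
    using support_subset xy(2,3) by metis+
  have e': "e = {bits n ?X, bits n ?Y}"
    using xy(1) bits_support[of x] bits_support[of y] unfolding xy(2,3) by simp
  with e sub obtain q where q: "sym_diff ?X ?Y = {q}"
    using bits_adjacent_iff by metis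
  then consider "?Y = insert q ?X" "q \<notin> ?X" | "?X = insert q ?Y" "q \<notin> ?Y"
    using sym_diff_singleton by metis
  then show "e \<in> {cube_edge n X q | X q. X \<subseteq> {..<n} \<and> q < n \<and> q \<notin> X}"
  proof cases
    case 1
    then show ?thesis using e' sub by (auto simp: cube_edge_def)
  next
    case 2
    then show ?thesis using e' sub by (fastforce simp: cube_edge_def insert_commute)
  qed
next
  fix e assume "e \<in> {cube_edge n X q | X q. X \<subseteq> {..<n} \<and> q < n \<and> q \<notin> X}"
  then obtain X q where "e = cube_edge n X q" "X \<subseteq> {..<n}" "q < n" "q \<notin> X" by blast
  moreover have "sym_diff X (insert q X) = {q}" using \<open>q \<notin> X\<close> by auto
  ultimately show "e \<in> edges (hypercube n)"
    unfolding cube_edge_def by (simp add: bits_adjacent_iff)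
qed

text \<open>Two vertices of a hypercube at distance two have exactly two common neighbours. For the
  neighbours of \<open>P\<close> in directions \<open>u\<close> and \<open>w\<close>, one of these
  is \<open>P\<close> itself, so \<open>Z\<close> is the other.\<close>

lemma common_neighbour:
  assumes "sym_diff (sym_diff P {u}) Z = {p}" "sym_diff (sym_diff P {w}) Z = {q}"
    and "u \<noteq> w" "Z \<noteq> P"
  shows "Z = sym_diff P {u, w}"
proof -
  have 1: "x \<in> Z \<longleftrightarrow> ((x \<in> P \<longleftrightarrow> x \<noteq> u) \<longleftrightarrow> x \<noteq> p)" for x
    using eqset_imp_iff[OF assms(1), of x] unfolding Un_iff Diff_iff singleton_iff by argo
  have 2: "x \<in> Z \<longleftrightarrow> ((x \<in> P \<longleftrightarrow> x \<noteq> w) \<longleftrightarrow> x \<noteq> q)" for x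
    using eqset_imp_iff[OF assms(2), of x] unfolding Un_iff Diff_iff singleton_iff by argo
  have "p \<noteq> u"
  proof
    assume "p = u"
    then have "x \<in> Z \<longleftrightarrow> x \<in> P" for x using 1[of x] by blast
    then have "Z = P" by (rule set_eqI)
    then show False using assms(4) by simp
  qed
  then have "p = w"
    using 1[of p] 2[of p] 1[of u] 2[of u] assms(3) by argo
  then have "x \<in> Z \<longleftrightarrow> x \<in> sym_diff P {u, w}" for x
    using 1[of x] assms(3) unfolding Un_iff Diff_iff insert_iff empty_iff by metis
  then show ?thesis by (rule set_eqI)
qed

text \<open>A cube minus its top vertex embeds only as a subcube minus a vertex: the directions are read
  off at the bottom, and then each vertex is determined by two of its lower neighbours.\<close>
lemma punctured_cube_rigid:
  fixes g :: "'a set \<Rightarrow> 'b set"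
  assumes "finite D" "2 \<le> card D"
    and inj: "inj_on g {S. S \<subset> D}"
    and adj: "\<And>S i. i \<notin> S \<Longrightarrow> insert i S \<subset> D \<Longrightarrow> \<exists>q. sym_diff (g S) (g (insert i S)) = {q}"
  obtains \<delta> where "inj_on \<delta> D" "\<And>S. S \<subset> D \<Longrightarrow> g S = sym_diff (g {}) (\<delta> ` S)"
proof -
  \<comment> \<open>The bound on \<open>card D\<close> puts every singleton into the domain, so that
    all directions can be read off at the bottom.\<close>
  have single: "{i} \<subset> D" if "i \<in> D" for i
    using that assms(2) by (auto simp: psubset_eq)
  have "\<forall>i\<in>D. \<exists>q. sym_diff (g {}) (g {i}) = {q}"
    using adj single by blast
  then obtain \<delta> where \<delta>: "\<And>i. i \<in> D \<Longrightarrow> sym_diff (g {}) (g {i}) = {\<delta> i}"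
    by metis
  have g1: "g {i} = sym_diff (g {}) {\<delta> i}" if "i \<in> D" for i
    using \<delta>[OF that] by (rule sym_diff_cancel)
  have inj\<delta>: "inj_on \<delta> D"
  proof (rule inj_onI)
    fix i j assume "i \<in> D" "j \<in> D" "\<delta> i = \<delta> j"
    then have "g {i} = g {j}" using g1 by simp
    then have "{i} = {j}"
      using inj_onD[OF inj, of "{i}" "{j}"] single[OF \<open>i \<in> D\<close>] single[OF \<open>j \<in> D\<close>]
      by (metis mem_Collect_eq)
    then show "i = j" by simp
  qed
  have "g S = sym_diff (g {}) (\<delta> ` S)" if "S \<subset> D" for S
    using that
  proof (induction "card S" arbitrary: S rule: less_induct)
    case less
    have fin: "finite S" using less.prems assms(1) by (meson finite_subset psubset_imp_subset)
    show ?case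
    proof (cases "\<exists>i\<in>S. \<exists>j\<in>S. i \<noteq> j")
      case False
      then have "S = {} \<or> (\<exists>i. S = {i})" by blast
      then show ?thesis using g1 less.prems by auto
    next
      case True
      then obtain i j where ij: "i \<in> S" "j \<in> S" "i \<noteq> j" by blast
      \<comment> \<open>The square over \<open>R\<close> in directions \<open>i\<close> and
        \<open>j\<close>: three corners are known by induction. The image of \<open>S\<close> is a
        common neighbour of two of them, and injectivity separates it from the third,
        \<open>g R\<close>.\<close>
      define R where "R = S - {i, j}"
      have S: "S = insert i (insert j R)" "i \<notin> R" "j \<notin> R" and D: "i \<in> D" "j \<in> D" "R \<subseteq> D"
        using ij less.prems by (auto simp: R_def)
      have ne: "\<delta> i \<noteq> \<delta> j" "\<delta> i \<notin> \<delta> ` R" "\<delta> j \<notin> \<delta> ` R"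
        using inj\<delta> S D ij(3) by (auto dest: inj_onD)
      have c: "card R < card S" "card (insert i R) < card S" "card (insert j R) < card S"
        using fin S ij(3) by (auto intro!: psubset_card_mono)
      have sub: "R \<subset> D" "insert i R \<subset> D" "insert j R \<subset> D"
        using less.prems S ij(3) by auto
      have gR: "g R = sym_diff (g {}) (\<delta> ` R)"
        and gi: "g (insert i R) = sym_diff (g R) {\<delta> i}"
        and gj: "g (insert j R) = sym_diff (g R) {\<delta> j}"
        using less.hyps[OF c(1) sub(1)] less.hyps[OF c(2) sub(2)] less.hyps[OF c(3) sub(3)]
        by (simp_all only: image_insert sym_diff_insert_right[OF ne(2)] sym_diff_insert_right[OF ne(3)])
      obtain p where p: "sym_diff (g (insert i R)) (g S) = {p}"
        using adj[of j "insert i R"] S ij(3) less.prems by (auto simp: insert_commute)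
      obtain q where q: "sym_diff (g (insert j R)) (g S) = {q}"
        using adj[of i "insert j R"] S ij(3) less.prems by auto
      have "g S \<noteq> g R"
        using inj_onD[OF inj, of S R] less.prems sub(1) c(1) by auto
      then have "g S = sym_diff (g R) {\<delta> i, \<delta> j}"
        using common_neighbour p q ne(1) unfolding gi gj by metis
      also have "\<dots> = sym_diff (g {}) (sym_diff (\<delta> ` R) {\<delta> i, \<delta> j})"
        unfolding gR by (rule sym_diff_assoc)
      also have "sym_diff (\<delta> ` R) {\<delta> i, \<delta> j} = \<delta> ` S"
        using ne unfolding S(1) by auto
      finally show ?thesis .
    qed
  qed
  with inj\<delta> show thesis using that by blast
qed

text \<open>\<open>B\<close> holds the coordinates fixed to one, \<open>D\<close> the free
  directions, and \<open>B \<union> E\<close> is the missing corner. The edge at that corner in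
  direction \<open>q\<close> has lower end \<open>B \<union> (E - {q})\<close>, so the inequality on
  \<open>X\<close> excludes precisely this edge.\<close>

lemma embedding_is_punctured_subcube:
  assumes v: "length v = 4" and "embedding (delete_vertex (hypercube 4) v) n H"
  obtains B D E where "B \<subseteq> {..<n}" "D \<subseteq> {..<n}" "card D = 4" "B \<inter> D = {}"
    "\<And>q X. q \<in> D \<Longrightarrow> X \<subseteq> D - {q} \<Longrightarrow> X \<noteq> E - {q} \<Longrightarrow> cube_edge n (B \<union> X) q \<in> edges H"
proof -
  let ?G = "delete_vertex (hypercube 4) v"
  \<comment> \<open>Translation by the complement of \<open>v\<close> moves the deleted vertex to
    the top \<open>{..<4}\<close>, the position required by
    \<open>punctured_cube_rigid\<close>.\<close>
  define U where "U = {..<4} - support v"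
  define h where "h S = bits 4 (sym_diff S U)" for S
  have v4: "v = bits 4 (support v)" "support v \<subseteq> {..<4}"
    using bits_support[of v] support_subset[of v] v by auto
  have U4: "U \<subseteq> {..<4}" by (auto simp: U_def)
  have h_verts: "h S \<in> verts ?G" if "S \<subset> {..<4}" for S
  proof -
    have "sym_diff S U \<subseteq> {..<4}" using that U4 by auto
    moreover have "sym_diff S U \<noteq> support v"
      using that v4(2) by (auto simp: U_def set_eq_iff)
    ultimately have "h S \<noteq> v" unfolding h_def using v4 bits_eq_iff by metis
    then show ?thesis by (simp add: delete_vertex_def hypercube_def h_def)
  qed
  have h_inj: "inj_on h {S. S \<subset> {..<4}}"
  proof (rule inj_onI)
    fix S T assume ST: "S \<in> {S. S \<subset> {..<4}}" "T \<in> {S. S \<subset> {..<4}}" "h S = h T"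
    have "sym_diff S U \<subseteq> {..<4}" "sym_diff T U \<subseteq> {..<4}" using ST U4 by auto
    then have "sym_diff S U = sym_diff T U" using ST(3) bits_eq_iff unfolding h_def by metis
    then show "S = T" by (auto simp: set_eq_iff)
  qed
  have h_adj: "{h S, h (insert i S)} \<in> edges ?G" if "i \<notin> S" "insert i S \<subset> {..<4}" for S i
  proof -
    have "S \<subset> {..<4}" using that by auto
    then have "h S \<noteq> v" "h (insert i S) \<noteq> v"
      using h_verts that(2) by (auto simp: delete_vertex_def)
    moreover have "sym_diff S U \<subseteq> {..<4}" "sym_diff (insert i S) U \<subseteq> {..<4}"
      using that U4 by auto
    moreover have "sym_diff (sym_diff S U) (sym_diff (insert i S) U) = {i}"
      using that by auto
    ultimately show ?thesis
      unfolding h_def delete_vertex_def by (auto simp: bits_adjacent_iff)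
  qed
  from assms(2) obtain f where sub: "subgraph H (hypercube n)"
    and f: "bij_betw f (verts ?G) (verts H)"
    and iso: "\<And>x y. x \<in> verts ?G \<Longrightarrow> y \<in> verts ?G \<Longrightarrow>
        {x, y} \<in> edges ?G \<longleftrightarrow> {f x, f y} \<in> edges H"
    unfolding embedding_def isomorphic_def by blast
  define g where "g S = support (f (h S))" for S
  have f_len: "length (f (h S)) = n" if "S \<subset> {..<4}" for S
    using f h_verts[OF that] sub
    by (auto simp: bij_betw_def subgraph_def hypercube_def)
  have g_sub: "g S \<subseteq> {..<n}" if "S \<subset> {..<4}" for S
    using f_len[OF that] support_subset unfolding g_def by metis
  have f_g: "f (h S) = bits n (g S)" if "S \<subset> {..<4}" for S
    using f_len[OF that] bits_support unfolding g_def by metis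
  have g_inj: "inj_on g {S. S \<subset> {..<4}}"
  proof (rule inj_onI)
    fix S T assume ST: "S \<in> {S. S \<subset> {..<4}}" "T \<in> {S. S \<subset> {..<4}}" "g S = g T"
    then have "f (h S) = f (h T)" using f_g by simp
    then have "h S = h T"
      using f inj_onD[of f "verts ?G" "h S" "h T"] h_verts[of S] h_verts[of T] ST(1,2)
      by (simp add: bij_betw_def)
    then show "S = T" using inj_onD[OF h_inj _ ST(1,2)] by simp
  qed
  have g_edge: "{bits n (g S), bits n (g (insert i S))} \<in> edges H"
    if "i \<notin> S" "insert i S \<subset> {..<4}" for S i
  proof -
    have S: "S \<subset> {..<4}" using that by auto
    then show ?thesis using h_adj[OF that] iso[OF h_verts[OF S] h_verts[OF that(2)]]
      f_g[OF S] f_g[OF that(2)] by simp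
  qed
  have g_adj: "\<exists>q. sym_diff (g S) (g (insert i S)) = {q}"
    if "i \<notin> S" "insert i S \<subset> {..<4}" for S i
  proof -
    have S: "S \<subset> {..<4}" using that by auto
    show ?thesis
      using g_edge[OF that] sub bits_adjacent_iff[OF g_sub[OF S] g_sub[OF that(2)]]
      by (auto simp: subgraph_def)
  qed
  obtain \<delta> where \<delta>: "inj_on \<delta> {..<4::nat}"
    and g\<delta>: "\<And>S. S \<subset> {..<4} \<Longrightarrow> g S = sym_diff (g {}) (\<delta> ` S)"
    using punctured_cube_rigid[of "{..<4::nat}" g] g_inj g_adj by auto
  \<comment> \<open>The deleted vertex would go to \<open>sym_diff (g {}) D\<close>, which is
    \<open>B\<close> together with \<open>D - g {}\<close>; hence \<open>D - g {}\<close> is the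
    \<open>E\<close> of the conclusion.\<close>
  define D where "D = \<delta> ` {..<4}"
  define B where "B = g {} - D"
  have "{} \<noteq> {..<4::nat}" by (metis lessThan_empty_iff zero_neq_numeral)
  then have g0: "g {} \<subseteq> {..<n}" by (intro g_sub psubsetI empty_subsetI)
  have D: "D \<subseteq> {..<n}"
  proof
    fix q assume "q \<in> D"
    then obtain i where i: "i < 4" "q = \<delta> i" by (auto simp: D_def)
    have "{i} \<subset> {..<4}" using i(1)
      by (metis card_lessThan card.empty card.insert finite.emptyI insert_absorb empty_iff lessThan_iff
          numeral_eq_one_iff psubsetI singletonD subsetI semiring_norm(83) One_nat_def)
    then show "q \<in> {..<n}" using g\<delta>[of "{i}"] g_sub[of "{i}"] g0 i by auto
  qed
  have edge: "cube_edge n (B \<union> X) q \<in> edges H"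
    if q: "q \<in> D" and X: "X \<subseteq> D - {q}" "X \<noteq> (D - g {}) - {q}" for q X
  proof -
    obtain i where i: "i < 4" "q = \<delta> i" using q by (auto simp: D_def)
    \<comment> \<open>Undo the translation by \<open>g {}\<close> in the directions other than
      \<open>q\<close>. The condition on \<open>X\<close> turns into
      \<open>Y \<noteq> D - {q}\<close>, that is, the upper end of the edge is not the deleted top.
      Whether \<open>q\<close> lies in \<open>g {}\<close> decides which end of the image is the
      lower one.\<close>
    define Y where "Y = sym_diff X (g {} \<inter> D - {q})"
    define S where "S = {j. j < 4 \<and> \<delta> j \<in> Y}"
    have Y: "Y \<subseteq> D - {q}" "Y \<noteq> D - {q}"
      using X by (auto simp: Y_def)
    have \<delta>S: "\<delta> ` S = Y" using Y by (auto simp: S_def D_def)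
    have iS: "i \<notin> S" using i Y by (auto simp: S_def)
    have "insert i S \<subseteq> {..<4}" using i by (auto simp: S_def)
    moreover have "insert i S \<noteq> {..<4}"
    proof
      assume "insert i S = {..<4}"
      then have "D = insert q Y" using \<delta>S i D_def by (metis image_insert)
      then show False using Y by auto
    qed
    ultimately have iS4: "insert i S \<subset> {..<4}" by auto
    then have S4: "S \<subset> {..<4}" by auto
    have gS: "g S = sym_diff (g {}) Y" and giS: "g (insert i S) = sym_diff (g {}) (insert q Y)"
      using g\<delta>[OF S4] g\<delta>[OF iS4] \<delta>S i by auto
    have "{g S, g (insert i S)} = {B \<union> X, insert q (B \<union> X)}"
    proof (cases "q \<in> g {}")
      case True
      then have "g S = insert q (B \<union> X)" "g (insert i S) = B \<union> X"
        unfolding gS giS B_def Y_def using q X(1) by auto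
      then show ?thesis by auto
    next
      case False
      then have "g (insert i S) = insert q (B \<union> X)" "g S = B \<union> X"
        unfolding gS giS B_def Y_def using q X(1) by auto
      then show ?thesis by auto
    qed
    then have "{bits n (g S), bits n (g (insert i S))} = cube_edge n (B \<union> X) q"
      unfolding cube_edge_def by (metis image_insert image_empty)
    then show ?thesis using g_edge[OF iS iS4] by simp
  qed
  have "card D = 4" using \<delta> by (simp add: D_def card_image)
  moreover have "B \<subseteq> {..<n}" "B \<inter> D = {}" using g0 by (auto simp: B_def)
  ultimately show thesis using D edge by (intro that[of B D "D - g {}"])
qed

text \<open>Used for the negative half, where one placement in each subcube is enough: the missing
  vertex is put at the bottom \<open>B\<close>, so that no edge of the copy has lower end
  \<open>B\<close>.\<close>

lemma punctured_subcube_embedding: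
  assumes v: "length v = 4"
    and BD: "B \<subseteq> {..<n}" "D \<subseteq> {..<n}" "card D = 4" "B \<inter> D = {}"
  obtains H where "embedding (delete_vertex (hypercube 4) v) n H"
    "\<And>e. e \<in> edges H \<Longrightarrow> \<exists>q\<in>D. \<exists>X\<subseteq>D - {q}. X \<noteq> {} \<and> e = cube_edge n (B \<union> X) q"
proof -
  let ?G = "delete_vertex (hypercube 4) v"
  let ?V = "support v"
  have "finite D" using BD(3) card.infinite by fastforce
  then obtain d where d: "bij_betw d {..<4::nat} D"
    using BD(3) by (metis bij_betw_iff_card card_lessThan finite_lessThan)
  \<comment> \<open>Translation by \<open>support v\<close> sends the deleted vertex to the empty
    set, hence to \<open>B\<close>.\<close>
  define F where "F S = B \<union> d ` sym_diff S ?V" for S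
  define f where "f x = bits n (F (support x))" for x
  have v4: "?V \<subseteq> {..<4}" using support_subset[of v] v by auto
  have d_in: "d ` S \<subseteq> D" if "S \<subseteq> {..<4}" for S
    using d that by (auto simp: bij_betw_def)
  have FB: "F S \<subseteq> {..<n}" if "S \<subseteq> {..<4}" for S
    using d_in[of "sym_diff S ?V"] that v4 BD unfolding F_def by blast
  have F_sd: "sym_diff (F S) (F T) = d ` sym_diff S T" if "S \<subseteq> {..<4}" "T \<subseteq> {..<4}" for S T
  proof -
    have "d ` sym_diff S ?V \<subseteq> D" "d ` sym_diff T ?V \<subseteq> D"
      using that v4 by (blast intro!: d_in)+
    then have "sym_diff (F S) (F T) = sym_diff (d ` sym_diff S ?V) (d ` sym_diff T ?V)"
      using BD(4) unfolding F_def by blast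
    also have "\<dots> = d ` sym_diff (sym_diff S ?V) (sym_diff T ?V)"
    proof -
      have inj: "inj_on d {..<4}" using d by (simp add: bij_betw_def)
      have sub: "sym_diff S ?V \<subseteq> {..<4}" "sym_diff T ?V \<subseteq> {..<4}" using that v4 by auto
      show ?thesis
        unfolding image_Un inj_on_image_set_diff[OF inj Diff_subset[THEN subset_trans, OF sub(1)] sub(2)]
          inj_on_image_set_diff[OF inj Diff_subset[THEN subset_trans, OF sub(2)] sub(1)] ..
    qed
    also have "sym_diff (sym_diff S ?V) (sym_diff T ?V) = sym_diff S T" by auto
    finally show ?thesis .
  qed
  have supp4: "support x \<subseteq> {..<4}" if "x \<in> verts ?G" for x
    using that support_subset[of x] by (simp add: delete_vertex_def hypercube_def)
  have f_inj: "inj_on f (verts ?G)"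
  proof (rule inj_onI)
    fix x y assume xy: "x \<in> verts ?G" "y \<in> verts ?G" "f x = f y"
    have "F (support x) = F (support y)"
      using xy(3) bits_eq_iff[OF FB[OF supp4[OF xy(1)]] FB[OF supp4[OF xy(2)]]] by (simp add: f_def)
    then have "sym_diff (support x) (support y) = {}"
      using F_sd[OF supp4[OF xy(1)] supp4[OF xy(2)]] by auto
    then have "support x = support y" by auto
    moreover have "length x = 4" "length y = 4" using xy by (auto simp: delete_vertex_def hypercube_def)
    ultimately show "x = y" using bits_support by metis
  qed
  have G_edge: "\<exists>x y. e = {x, y} \<and> x \<in> verts ?G \<and> y \<in> verts ?G \<and> x \<noteq> y" if "e \<in> edges ?G" for e
  proof -
    obtain x y where e: "e = {x, y}" "length x = 4" "length y = 4"
      "card {i. i < 4 \<and> x ! i \<noteq> y ! i} = 1" "v \<notin> e"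
      using \<open>e \<in> edges ?G\<close> by (auto simp: delete_vertex_def hypercube_def)
    then have "x \<noteq> y" by auto
    with e show ?thesis by (auto simp: delete_vertex_def hypercube_def)
  qed
  define H where "H = \<lparr>verts = f ` verts ?G, edges = (`) f ` edges ?G\<rparr>"
  have edge_form: "\<exists>q\<in>D. \<exists>X\<subseteq>D - {q}. X \<noteq> {} \<and> f ` e = cube_edge n (B \<union> X) q"
    if e: "e \<in> edges ?G" for e
  proof -
    have "e \<in> edges (hypercube 4)" "v \<notin> e" using e by (auto simp: delete_vertex_def)
    then obtain S i where S: "e = cube_edge 4 S i" "S \<subseteq> {..<4}" "i < 4" "i \<notin> S"
      unfolding edges_hypercube by blast
    have "bits 4 ?V = v" using bits_support[of v] v by simp
    \<comment> \<open>Together these say that \<open>S\<close> and \<open>support v\<close> differ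
      in some coordinate other than \<open>i\<close>, which makes the lower end of the image
      different from \<open>B\<close>.\<close>
    then have neV: "S \<noteq> ?V" "insert i S \<noteq> ?V"
      using \<open>v \<notin> e\<close> S(1) by (auto simp: cube_edge_def)
    let ?X = "d ` (sym_diff S ?V - {i})"
    have inj: "inj_on d {..<4}" using d by (simp add: bij_betw_def)
    have sub: "sym_diff S ?V - {i} \<subseteq> {..<4}" using S(2) v4 by auto
    have dX: "d i \<notin> ?X"
      using inj_onD[OF inj, of i] sub S(3) by auto
    have fe: "f ` e = {bits n (F S), bits n (F (insert i S))}"
      using S by (auto simp: cube_edge_def f_def support_bits inf.absorb1)
    have "f ` e = cube_edge n (B \<union> ?X) (d i)"
    proof (cases "i \<in> ?V")
      case True
      then have "sym_diff S ?V = insert i (sym_diff S ?V - {i})"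
        "sym_diff (insert i S) ?V = sym_diff S ?V - {i}" using S(4) by auto
      then have "F S = insert (d i) (B \<union> ?X)" "F (insert i S) = B \<union> ?X"
        unfolding F_def by (metis Un_insert_right image_insert, metis)
      then show ?thesis unfolding fe cube_edge_def by auto
    next
      case False
      then have "sym_diff (insert i S) ?V = insert i (sym_diff S ?V - {i})"
        "sym_diff S ?V = sym_diff S ?V - {i}" using S(4) by auto
      then have "F (insert i S) = insert (d i) (B \<union> ?X)" "F S = B \<union> ?X"
        unfolding F_def by (metis Un_insert_right image_insert, metis)
      then show ?thesis unfolding fe cube_edge_def by auto
    qed
    moreover have "?X \<subseteq> D - {d i}"
      using d_in[OF sub] dX by (simp only: subset_Diff_insert Diff_empty) simp
    moreover have "?X \<noteq> {}" using neV S(4) by auto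
    moreover have "d i \<in> D" using d S(3) by (auto simp: bij_betw_def)
    ultimately show ?thesis by blast
  qed
  have edge_sub: "edges H \<subseteq> edges (hypercube n)"
  proof
    fix e assume "e \<in> edges H"
    then obtain e' where "e' \<in> edges ?G" "e = f ` e'" by (auto simp: H_def)
    then obtain q X where "q \<in> D" "X \<subseteq> D - {q}" "e = cube_edge n (B \<union> X) q"
      using edge_form by metis
    then show "e \<in> edges (hypercube n)"
      unfolding edges_hypercube using BD by blast
  qed
  have "simple_graph H"
    unfolding simple_graph_def
  proof
    fix e assume "e \<in> edges H"
    then obtain e' where e': "e' \<in> edges ?G" "e = f ` e'" by (auto simp: H_def)
    obtain x y where xy: "e' = {x, y}" "x \<in> verts ?G" "y \<in> verts ?G" "x \<noteq> y"
      using G_edge[OF e'(1)] by blast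
    then have "f x \<noteq> f y" using f_inj by (auto dest: inj_onD)
    with xy e' show "e \<subseteq> verts H \<and> card e = 2" by (auto simp: H_def)
  qed
  then have "subgraph H (hypercube n)"
    using edge_sub by (auto simp: subgraph_def H_def hypercube_def f_def)
  moreover have "isomorphic ?G H"
    unfolding isomorphic_def
  proof (intro exI[of _ f] conjI ballI)
    show "bij_betw f (verts ?G) (verts H)" using f_inj by (simp add: bij_betw_def H_def)
    fix x y assume xy: "x \<in> verts ?G" "y \<in> verts ?G"
    show "{x, y} \<in> edges ?G \<longleftrightarrow> {f x, f y} \<in> edges H"
    proof
      assume "{x, y} \<in> edges ?G"
      then have "f ` {x, y} \<in> edges H" unfolding H_def ugraph.select_convs by (rule imageI)
      then show "{f x, f y} \<in> edges H" by simp
    next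
      assume "{f x, f y} \<in> edges H"
      then obtain e where e: "e \<in> edges ?G" "f ` e = f ` {x, y}" by (auto simp: H_def)
      have "e \<subseteq> verts ?G" using G_edge[OF e(1)] by auto
      then have "e = {x, y}" using e(2) xy f_inj inj_on_image_eq_iff
        by (metis empty_subsetI insert_subset)
      then show "{x, y} \<in> edges ?G" using e(1) by simp
    qed
  qed
  ultimately have "embedding ?G n H" by (simp add: embedding_def)
  moreover have "\<exists>q\<in>D. \<exists>X\<subseteq>D - {q}. X \<noteq> {} \<and> e = cube_edge n (B \<union> X) q"
    if "e \<in> edges H" for e
    using that edge_form unfolding H_def ugraph.select_convs by blast
  ultimately show thesis using that by blast
qed

subsection \<open>A colouring with five colours\<close>

definition rank :: "nat set \<Rightarrow> nat \<Rightarrow> nat" where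
  "rank T t = card (T \<inter> {..<t})"

lemma rank_strict_mono: "finite T \<Longrightarrow> s \<in> T \<Longrightarrow> s < t \<Longrightarrow> rank T s < rank T t"
  unfolding rank_def by (rule psubset_card_mono) auto

lemma rank_less_card: "finite T \<Longrightarrow> t \<in> T \<Longrightarrow> rank T t < card T"
  unfolding rank_def by (rule psubset_card_mono) auto

lemma rank_inj: "finite T \<Longrightarrow> s \<in> T \<Longrightarrow> t \<in> T \<Longrightarrow> rank T s = rank T t \<Longrightarrow> s = t"
  by (metis linorder_neqE_nat rank_strict_mono less_irrefl)

lemma card_split_at:
  assumes "finite X" "q \<notin> X"
  shows "card X = rank X q + card (X \<inter> {q<..})"
proof -
  have "X = (X \<inter> {..<q}) \<union> (X \<inter> {q<..})" using assms(2) by (auto simp: not_less order.order_iff_strict)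
  then have "card X = card ((X \<inter> {..<q}) \<union> (X \<inter> {q<..}))" by (rule arg_cong)
  also have "\<dots> = rank X q + card (X \<inter> {q<..})"
    unfolding rank_def using assms(1) by (intro card_Un_disjoint) auto
  finally show ?thesis .
qed

lemma rank_Un: "finite A \<Longrightarrow> finite B \<Longrightarrow> A \<inter> B = {} \<Longrightarrow> rank (A \<union> B) q = rank A q + rank B q"
  unfolding rank_def Int_Un_distrib2 by (rule card_Un_disjoint) auto

definition ones_residue :: "nat set \<Rightarrow> nat \<Rightarrow> nat" where
  "ones_residue X q = (rank X q + 2 * card (X \<inter> {q<..})) mod 5"

text \<open>Recovers lower end and flipped coordinate from an unordered edge: the intersection of
  the two supports, and the single element by which the union exceeds it.\<close>

definition residue_coloring :: "bool list set \<Rightarrow> nat" where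
  "residue_coloring e = ones_residue (\<Inter>(support ` e)) (the_elem (\<Union>(support ` e) - \<Inter>(support ` e)))"

lemma residue_coloring_cube_edge:
  assumes "X \<subseteq> {..<n}" "q < n" "q \<notin> X"
  shows "residue_coloring (cube_edge n X q) = ones_residue X q"
proof -
  have "support ` cube_edge n X q = {X, insert q X}"
    using assms by (simp add: cube_edge_def support_bits inf.absorb1)
  moreover have "insert q X - X = {q}" using assms(3) by auto
  ultimately show ?thesis by (simp add: residue_coloring_def Un_absorb1 Int_absorb2 subset_insertI)
qed

text \<open>A deleted corner forbids only one set \<open>F\<close> in each direction, so a residue
  attained by two different sets survives.\<close>

lemma two_candidates:
  "Y \<subseteq> S \<Longrightarrow> Z \<subseteq> S \<Longrightarrow> Y \<noteq> Z \<Longrightarrow> P Y \<Longrightarrow> P Z \<Longrightarrow> \<exists>X\<subseteq>S. X \<noteq> F \<and> P X"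
  by metis

text \<open>One of the two middle directions always works: a corner whose removal destroys a residue in
  the second direction leaves all residues in the third.\<close>
lemma residues_in_punctured_subcube:
  assumes "finite B" "B \<inter> D = {}" "card D = 4" "k < 5"
  obtains q X where "q \<in> D" "X \<subseteq> D - {q}" "X \<noteq> E - {q}" "ones_residue (B \<union> X) q = k"
proof -
  have "D \<in> nsets D 4" using assms(3) card.infinite[of D] by (fastforce simp: nsets_def)
  then obtain p1 p2 p3 p4 where D: "D = {p1, p2, p3, p4}" and less: "p1 < p2" "p2 < p3" "p3 < p4"
    unfolding ordered_nsets_4_eq by blast
  define f where "f q X = rank X q + 2 * card (X \<inter> {q<..})" for q X
  \<comment> \<open>The base \<open>B\<close> shifts all values in direction \<open>q\<close> by the
    constant \<open>f q B\<close>, so it suffices to reach every residue with \<open>X\<close>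
    alone.\<close>
  have shift: "ones_residue (B \<union> X) q = (f q B + f q X) mod 5" if "X \<subseteq> D" for q X
  proof -
    have fin: "finite X" "B \<inter> X = {}" using that assms(2) D finite_subset by auto
    have "card ((B \<union> X) \<inter> {q<..}) = card (B \<inter> {q<..}) + card (X \<inter> {q<..})"
      unfolding Int_Un_distrib2 using fin assms(1) by (intro card_Un_disjoint) auto
    then show ?thesis
      using rank_Un[OF assms(1) fin] by (simp add: ones_residue_def f_def ac_simps)
  qed
  have "\<exists>q\<in>D. \<forall>s<5. \<exists>X\<subseteq>D - {q}. X \<noteq> E - {q} \<and> f q X mod 5 = s"
  \<comment> \<open>In direction \<open>p2\<close>, one element on the left counts 1 and two on the
    right count 2 each. Only the residues 1 and 4 are attained just once, by \<open>{p1}\<close> and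
    \<open>{p3, p4}\<close>; the direction works unless one of these is forbidden.\<close>
  proof (cases "E - {p2} \<noteq> {p1} \<and> E - {p2} \<noteq> {p3, p4}")
    case True
    have ff: "f p2 {} = 0" "f p2 {p1, p3, p4} = 5" "f p2 {p1} = 1" "f p2 {p3} = 2" "f p2 {p4} = 2"
      "f p2 {p1, p3} = 3" "f p2 {p1, p4} = 3" "f p2 {p3, p4} = 4"
      using less by (simp_all add: f_def rank_def)
    have ne: "{} \<noteq> {p1, p3, p4}" "{p3} \<noteq> {p4}" "{p1, p3} \<noteq> {p1, p4}"
      using less by (auto simp: doubleton_eq_iff)
    have sub: "{p1, p3, p4} \<subseteq> D - {p2}" using D less by auto
    have nF: "{p1} \<noteq> E - {p2}" "{p3, p4} \<noteq> E - {p2}" using True by metis+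
    have "\<exists>X\<subseteq>{p1, p3, p4}. X \<noteq> E - {p2} \<and> f p2 X mod 5 = s" if s: "s < 5" for s
    proof -
      consider "s = 0" | "s = 1" | "s = 2" | "s = 3" | "s = 4" using s by linarith
      then show ?thesis
      proof cases
        case 1
        show ?thesis
          by (rule two_candidates[of "{}" _ "{p1, p3, p4}"]) (use less in \<open>simp_all add: ff ne 1\<close>)
      next
        case 2
        show ?thesis
          by (intro exI[of _ "{p1}"] conjI nF) (simp_all add: ff 2)
      next
        case 3
        show ?thesis
          by (rule two_candidates[of "{p3}" _ "{p4}"]) (use less in \<open>simp_all add: ff ne 3\<close>)
      next
        case 4
        show ?thesis
          by (rule two_candidates[of "{p1, p3}" _ "{p1, p4}"]) (use less in \<open>simp_all add: ff ne 4\<close>)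
      next
        case 5
        show ?thesis
          by (intro exI[of _ "{p3, p4}"] conjI nF) (simp_all add: ff 5)
      qed
    qed
    then show ?thesis using sub D by (meson insertCI subset_trans)
  next
    case False
    have ff: "f p3 {} = 0" "f p3 {p1, p2, p4} = 4" "f p3 {p1} = 1" "f p3 {p2} = 1" "f p3 {p4} = 2"
      "f p3 {p1, p2} = 2" "f p3 {p1, p4} = 3" "f p3 {p2, p4} = 3"
      using less by (simp_all add: f_def rank_def)
    have ne: "{p1} \<noteq> {p2}" "{p4} \<noteq> {p1, p2}" "{p1, p4} \<noteq> {p2, p4}"
      using less by (auto simp: doubleton_eq_iff)
    have sub: "{p1, p2, p4} \<subseteq> D - {p3}" using D less by auto
    \<comment> \<open>In direction \<open>p3\<close> only the residues 0 and 4 are attained just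
      once, by the empty and the full set. In the present case the forbidden set contains exactly
      one of \<open>p1\<close> and \<open>p4\<close>, so it is neither.\<close>
    have nF: "{} \<noteq> E - {p3}" "{p1, p2, p4} \<noteq> E - {p3}"
    proof -
      have mem: "p1 \<in> E - {p2} \<longleftrightarrow> p1 \<in> E - {p3}" "p4 \<in> E - {p2} \<longleftrightarrow> p4 \<in> E - {p3}"
        using less by auto
      have "p1 \<in> E - {p2} \<longleftrightarrow> p4 \<notin> E - {p2}"
      proof (cases "E - {p2} = {p1}")
        case True
        show ?thesis unfolding True using less by simp
      next
        case F: False
        then have F': "E - {p2} = {p3, p4}" using False by metis
        show ?thesis unfolding F' using less by simp
      qed
      then have "p1 \<in> E - {p3} \<longleftrightarrow> p4 \<notin> E - {p3}" unfolding mem .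
      then show "{} \<noteq> E - {p3}" "{p1, p2, p4} \<noteq> E - {p3}"
        by (metis empty_iff, metis insertCI)
    qed
    have "\<exists>X\<subseteq>{p1, p2, p4}. X \<noteq> E - {p3} \<and> f p3 X mod 5 = s" if s: "s < 5" for s
    proof -
      consider "s = 0" | "s = 1" | "s = 2" | "s = 3" | "s = 4" using s by linarith
      then show ?thesis
      proof cases
        case 1
        show ?thesis
          by (intro exI[of _ "{}"] conjI nF) (simp_all add: ff 1)
      next
        case 2
        show ?thesis
          by (rule two_candidates[of "{p1}" _ "{p2}"]) (use less in \<open>simp_all add: ff ne 2\<close>)
      next
        case 3
        show ?thesis
          by (rule two_candidates[of "{p4}" _ "{p1, p2}"]) (use less in \<open>simp_all add: ff ne 3\<close>)
      next
        case 4
        show ?thesis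
          by (rule two_candidates[of "{p1, p4}" _ "{p2, p4}"]) (use less in \<open>simp_all add: ff ne 4\<close>)
      next
        case 5
        show ?thesis
          by (intro exI[of _ "{p1, p2, p4}"] conjI nF) (simp_all add: ff 5)
      qed
    qed
    then show ?thesis using sub D by (meson insertCI subset_trans)
  qed
  then obtain q where q: "q \<in> D" "\<And>s. s < 5 \<Longrightarrow> \<exists>X\<subseteq>D - {q}. X \<noteq> E - {q} \<and> f q X mod 5 = s"
    by blast
  \<comment> \<open>Modulo 5, \<open>4 * f q B\<close> stands for minus \<open>f q B\<close> and
    avoids subtraction of natural numbers.\<close>
  have "(k + 4 * f q B) mod 5 < 5" by simp
  from q(2)[OF this] obtain X where X: "X \<subseteq> D - {q}" "X \<noteq> E - {q}"
    "f q X mod 5 = (k + 4 * f q B) mod 5"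
    by blast
  have "(f q B + f q X) mod 5 = (f q B + (k + 4 * f q B)) mod 5"
    using X(3) mod_add_cong by blast
  also have "\<dots> = k" using assms(4) by presburger
  finally have "ones_residue (B \<union> X) q = k" using shift X(1) by auto
  with q(1) X show thesis using that by blast
qed

lemma polychromatic_colorable_5:
  assumes "length v = 4"
  shows "polychromatic_colorable (delete_vertex (hypercube 4) v) 5"
proof -
  have "polychromatic_coloring (delete_vertex (hypercube 4) v) 5 n residue_coloring" for n
    unfolding polychromatic_coloring_def
  proof (intro conjI allI impI)
    show "residue_coloring \<in> edges (hypercube n) \<rightarrow> {..<5}"
      by (simp add: residue_coloring_def ones_residue_def)
    fix H and k :: nat assume H: "embedding (delete_vertex (hypercube 4) v) n H" and k: "k < 5"
    from embedding_is_punctured_subcube[OF assms H] obtain B D E where BDE: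
      "B \<subseteq> {..<n}" "D \<subseteq> {..<n}" "card D = 4" "B \<inter> D = {}"
      and edge: "\<And>q X. q \<in> D \<Longrightarrow> X \<subseteq> D - {q} \<Longrightarrow> X \<noteq> E - {q} \<Longrightarrow> cube_edge n (B \<union> X) q \<in> edges H"
      by metis
    have "finite B" using BDE(1) finite_subset by blast
    from residues_in_punctured_subcube[OF this BDE(4,3) k] obtain q X where
      X: "q \<in> D" "X \<subseteq> D - {q}" "X \<noteq> E - {q}" and res: "ones_residue (B \<union> X) q = k"
      by metis
    have "B \<union> X \<subseteq> {..<n}" "q < n" "q \<notin> B \<union> X"
      using X BDE by auto
    then show "\<exists>e\<in>edges H. residue_coloring e = k"
      using residue_coloring_cube_edge[of "B \<union> X" n q] res edge[OF X] by metis
  qed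
  then show ?thesis unfolding polychromatic_colorable_def by blast
qed

subsection \<open>Six colours are too many\<close>

text \<open>Ramsey's theorem for \<open>m\<close>-sets \<open>T\<close>, coloured by the colours of all pairs inside the initial
  segments of \<open>T\<close>; a set with fewer than \<open>m\<close> elements becomes an initial segment of an
  \<open>m\<close>-set by adding large elements.\<close>
lemma simple_subcolouring:
  fixes m r :: nat
  obtains N where "\<And>col :: nat set \<Rightarrow> nat \<Rightarrow> nat.
    (\<And>X q. X \<subseteq> {..<N} \<Longrightarrow> q < N \<Longrightarrow> q \<notin> X \<Longrightarrow> col X q < r) \<Longrightarrow>
    \<exists>e \<chi>. strict_mono_on {..<m} e \<and> e ` {..<m} \<subseteq> {..<N} \<and>
      (\<forall>X q. X \<subseteq> {..<m} \<longrightarrow> q < m \<longrightarrow> q \<notin> X \<longrightarrow> col (e ` X) (e q) = \<chi> (card X) (rank X q))"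
proof -
  define P where "P = {..m} \<times> {..<m} \<rightarrow>\<^sub>E {..<Suc r}"
  have "finite P" unfolding P_def by (intro finite_PiE) auto
  then obtain enc where enc: "bij_betw enc P {..<card P}"
    using ex_bij_betw_finite_nat atLeast0LessThan by metis
  \<comment> \<open>A homogeneous set of size \<open>2 * m\<close> provides \<open>m\<close>
    coordinates for the subcube and \<open>m\<close> larger ones for padding.\<close>
  obtain N where N: "partn_lst {..<N::nat} (replicate (card P) (2 * m)) m"
    using ramsey_full by blast
  show thesis
  proof (rule that[of N])
    fix col :: "nat set \<Rightarrow> nat \<Rightarrow> nat"
    assume col: "\<And>X q. X \<subseteq> {..<N} \<Longrightarrow> q < N \<Longrightarrow> q \<notin> X \<Longrightarrow> col X q < r"
    \<comment> \<open>Entry \<open>(k, j)\<close> is the colour for flipping the element of rank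
      \<open>j\<close> when the others among the first \<open>k\<close> are the ones. The cap at
      \<open>r\<close> keeps \<open>pat T\<close> in the finite set \<open>P\<close> for every
      \<open>T\<close>, even where no bound on \<open>col\<close> is assumed.\<close>
    define pat where "pat T = (\<lambda>(k, j)\<in>{..m} \<times> {..<m}.
      min r (col {t \<in> T. rank T t < k \<and> rank T t \<noteq> j} (THE t. t \<in> T \<and> rank T t = j)))" for T
    have patP: "pat T \<in> P" for T
      by (auto simp: pat_def P_def)
    have enc_less: "enc (pat T) < card P" for T
      using bij_betwE[OF enc] patP by auto
    have "(\<lambda>T. enc (pat T)) \<in> nsets {..<N} m \<rightarrow> {..<card P}"
      using enc_less by auto
    from partn_lstE[OF N this] obtain i S where i: "i < card P"
      and S: "S \<in> nsets {..<N} (2 * m)" "(\<lambda>T. enc (pat T)) ` nsets S m \<subseteq> {i}"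
      by (auto simp del: nsets_eq_empty_iff)
    have S': "S \<subseteq> {..<N}" "finite S" "card S = 2 * m"
      using S(1) by (auto simp: nsets_def)
    define p where "p = inv_into P enc i"
    have homog: "pat T = p" if "T \<subseteq> S" "card T = m" for T
    proof -
      have "T \<in> nsets S m" using that S'(2) by (auto simp: nsets_def intro: finite_subset)
      then have "enc (pat T) = i" using S(2) by auto
      then show ?thesis using enc patP unfolding p_def bij_betw_def by auto
    qed
    obtain e where e: "bij_betw e {..<card S} S" "strict_mono_on {..<card S} e"
      using ex_bij_betw_strict_mono_card[OF S'(2)] by blast
    have e_mono: "e a < e b \<longleftrightarrow> a < b" if "a < 2 * m" "b < 2 * m" for a b
      using that e(2) S'(3) by (simp add: strict_mono_on_less)
    have e_inj: "inj_on e {..<2 * m}" and e_S: "e ` {..<2 * m} = S"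
      using e(1) S'(3) by (auto simp: bij_betw_def)
    \<comment> \<open>With \<open>k\<close> ones, the initial segment has \<open>Suc k\<close>
      elements, since it contains the flipped coordinate as well.\<close>
    define \<chi> where "\<chi> k j = p (Suc k, j)" for k j
    have "col (e ` X) (e q) = \<chi> (card X) (rank X q)"
      if X: "X \<subseteq> {..<m}" and q: "q < m" "q \<notin> X" for X q
    proof -
      have finX: "finite X" using X finite_subset by blast
      have eqX: "e q \<notin> e ` X"
      proof -
        have "X \<subseteq> {..<2 * m}" by (rule subset_trans[OF X]) simp
        then show ?thesis using inj_on_image_mem_iff[OF e_inj, of q X] q by simp
      qed
      define k where "k = Suc (card X)"
      define T0 where "T0 = insert q X"
      \<comment> \<open>These \<open>m - k\<close> elements lie above all of \<open>T0\<close>, so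
        \<open>T0\<close> is the initial segment of size \<open>k\<close> in the padded
        \<open>m\<close>-set.\<close>
      define pad where "pad = {m..<2 * m - k}"
      have T0: "T0 \<subseteq> {..<m}" "finite T0" "card T0 = k"
        using X q finX by (auto simp: T0_def k_def)
      have km: "k \<le> m" using T0 card_mono[of "{..<m}" T0] by simp
      define U where "U = T0 \<union> pad"
      define T where "T = e ` U"
      have U: "U \<subseteq> {..<2 * m}" "finite U" "card U = m"
      proof -
        show "U \<subseteq> {..<2 * m}" using T0 by (auto simp: U_def pad_def)
        show "finite U" using T0 by (simp add: U_def pad_def)
        have "T0 \<inter> pad = {}" using T0 by (auto simp: pad_def)
        then show "card U = m"
          using T0 km card_Un_disjoint[of T0 pad] by (simp add: U_def pad_def)
      qed
      have T: "T \<subseteq> S" "card T = m" "finite T"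
        using U e_S inj_on_subset[OF e_inj U(1)] by (auto simp: T_def card_image)
      have rank_T: "rank T (e t) = rank U t" if "t \<in> U" for t
      proof -
        have lt: "e s < e t \<longleftrightarrow> s < t" if "s \<in> U" for s
          using e_mono[of s t] that \<open>t \<in> U\<close> U(1) by (metis lessThan_iff subsetD)
        have "T \<inter> {..<e t} = e ` (U \<inter> {..<t})"
          using lt by (auto simp: T_def)
        then show ?thesis unfolding rank_def
          using card_image inj_on_subset[OF e_inj] U(1) by (metis le_infI1)
      qed
      have rank_T0: "rank U t = rank T0 t" if "t \<in> T0" for t
      proof -
        have "U \<inter> {..<t} = T0 \<inter> {..<t}" using that T0 by (auto simp: U_def pad_def)
        then show ?thesis by (simp add: rank_def)
      qed
      have rank_pad: "k \<le> rank U t" if "t \<in> pad" for t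
      proof -
        have "T0 \<subseteq> U \<inter> {..<t}" using that T0 by (auto simp: U_def pad_def)
        then have "card T0 \<le> rank U t" unfolding rank_def by (intro card_mono) auto
        then show ?thesis using T0 by simp
      qed
      have rank_q: "rank T (e q) = rank X q" "q \<in> T0"
      proof -
        show "q \<in> T0" by (simp add: T0_def)
        then have "rank T (e q) = rank T0 q" using rank_T rank_T0 by (auto simp: U_def)
        also have "T0 \<inter> {..<q} = X \<inter> {..<q}" by (auto simp: T0_def)
        then have "rank T0 q = rank X q" by (simp add: rank_def)
        finally show "rank T (e q) = rank X q" .
      qed
      have eq_T: "e q \<in> T" using rank_q by (auto simp: T_def U_def)
      have star: "(THE t. t \<in> T \<and> rank T t = rank X q) = e q"
        using rank_q eq_T rank_inj[OF T(3)] by (intro the_equality) auto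
      have ones: "{t \<in> T. rank T t < k \<and> rank T t \<noteq> rank X q} = e ` X"
      proof (intro equalityI subsetI)
        fix t assume t: "t \<in> {t \<in> T. rank T t < k \<and> rank T t \<noteq> rank X q}"
        then obtain u where u: "u \<in> U" "t = e u" by (auto simp: T_def)
        with t have "rank U u < k" "u \<noteq> q" using rank_T rank_q by auto
        with u rank_pad have "u \<in> X" by (force simp: U_def T0_def)
        then show "t \<in> e ` X" using u by simp
      next
        fix t assume "t \<in> e ` X"
        then obtain u where u: "u \<in> X" "t = e u" by auto
        then have uT: "u \<in> T0" "u \<in> U" by (auto simp: T0_def U_def)
        have tT: "t \<in> T" using u uT by (auto simp: T_def)
        have "rank T t < k" using rank_T rank_T0 uT u rank_less_card[OF T0(2)] T0(3) by auto
        moreover have "rank T t \<noteq> rank X q"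
        proof
          assume "rank T t = rank X q"
          then have "e u = e q" using rank_inj[OF T(3) tT eq_T] rank_q u by simp
          then show False using eqX u by (metis imageI)
        qed
        ultimately show "t \<in> {t \<in> T. rank T t < k \<and> rank T t \<noteq> rank X q}" using tT by simp
      qed
      have "rank X q < m"
        using rank_less_card[OF T(3) eq_T] rank_q T(2) by simp
      then have "pat T (k, rank X q) = min r (col (e ` X) (e q))"
        using km by (simp add: pat_def ones star)
      moreover have "col (e ` X) (e q) < r"
      proof (rule col)
        show "e ` X \<subseteq> {..<N}" using X e_S S'(1) by fastforce
        show "e q < N" using eq_T T S'(1) by auto
        show "e q \<notin> e ` X" by (rule eqX)
      qed
      ultimately show ?thesis
        using homog[OF T(1,2)] by (simp add: \<chi>_def k_def)
    qed
    moreover have "strict_mono_on {..<m} e"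
      using e_mono by (auto simp: strict_mono_on_def)
    moreover have "e ` {..<m} \<subseteq> {..<N}"
    proof -
      have "e ` {..<m} \<subseteq> e ` {..<2 * m}" by (intro image_mono) simp
      then show ?thesis using e_S S'(1) by simp
    qed
    ultimately show "\<exists>e \<chi>. strict_mono_on {..<m} e \<and> e ` {..<m} \<subseteq> {..<N} \<and>
      (\<forall>X q. X \<subseteq> {..<m} \<longrightarrow> q < m \<longrightarrow> q \<notin> X \<longrightarrow> col (e ` X) (e q) = \<chi> (card X) (rank X q))"
      by blast
  qed
qed

section \<open>Counting a colour along runs of positions\<close>

lemma sum_shift_le:
  fixes f :: "nat \<Rightarrow> nat"
  assumes "x \<le> 3"
  shows "(\<Sum>A\<in>{l..<u}. f (A + x)) \<le> (\<Sum>A\<in>{l..<u + 3}. f A)"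
proof -
  have "(\<Sum>A\<in>{l..<u}. f (A + x)) = (\<Sum>A\<in>{l + x..<u + x}. f A)"
    by (simp add: sum.shift_bounds_nat_ivl)
  also have "\<dots> \<le> (\<Sum>A\<in>{l..<u + 3}. f A)"
    using assms by (intro sum_mono2) auto
  finally show ?thesis .
qed

lemma maximal_run:
  fixes P :: "nat \<Rightarrow> bool"
  assumes "l \<le> N"
  obtains u where "l \<le> u" "u \<le> N" "\<forall>A\<in>{l..<u}. P A" "u = N \<or> \<not> P u"
proof (cases "\<exists>A. l \<le> A \<and> A < N \<and> \<not> P A")
  case True
  define u where "u = (LEAST A. l \<le> A \<and> A < N \<and> \<not> P A)"
  have "l \<le> u \<and> u < N \<and> \<not> P u" unfolding u_def using True by (rule LeastI_ex)
  moreover have "\<forall>A\<in>{l..<u}. P A"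
    using calculation not_less_Least[of _ "\<lambda>A. l \<le> A \<and> A < N \<and> \<not> P A"] unfolding u_def
    by (meson atLeastLessThan_iff le_trans less_imp_le order_less_trans)
  ultimately show ?thesis using that by auto
next
  case False
  then show ?thesis using assms by (intro that[of N]) (auto simp: not_less)
qed

text \<open>\<open>cell s a\<close> is the colour of the edges with \<open>W + s\<close> ones, \<open>a\<close> of them to the left of the
  flipped coordinate. The edges in the \<open>i\<close>-th direction of a subcube punctured at its bottom vertex,
  with \<open>A\<close> base ones on the left, occupy an \<open>i\<close> by \<open>5 - i\<close> rectangle of cells minus a corner.\<close>
definition block :: "(nat \<Rightarrow> nat \<Rightarrow> nat) \<Rightarrow> nat \<Rightarrow> nat \<Rightarrow> nat set" where
  "block cell i A = {cell (x + y) (A + x) | x y. x < i \<and> y < 5 - i \<and> 0 < x + y}"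

text \<open>The coefficients 2, 2, 1 are the largest numbers of cells that a block has on levels 1,
  2, 3, attained by the two middle shapes. Their sum 5 is the source of the density 1/5.\<close>

definition weight :: "(nat \<Rightarrow> nat \<Rightarrow> nat) \<Rightarrow> nat \<Rightarrow> nat \<Rightarrow> nat" where
  "weight cell c A = 2 * of_bool (cell 1 A = c) + 2 * of_bool (cell 2 A = c) + of_bool (cell 3 A = c)"

lemma block_1: "block cell 1 A = {cell 1 A, cell 2 A, cell 3 A}"
  and block_2: "block cell 2 A =
    {cell 1 A, cell 1 (A + 1), cell 2 A, cell 2 (A + 1), cell 3 (A + 1)}"
  and block_3: "block cell 3 A =
    {cell 1 A, cell 1 (A + 1), cell 2 (A + 1), cell 2 (A + 2), cell 3 (A + 2)}"
  and block_4: "block cell 4 A = {cell 1 (A + 1), cell 2 (A + 2), cell 3 (A + 3)}"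
proof -
  have less: "a < 1 \<longleftrightarrow> a = 0" "a < 2 \<longleftrightarrow> a = 0 \<or> a = 1" "a < 3 \<longleftrightarrow> a = 0 \<or> a = 1 \<or> a = 2"
    "a < 4 \<longleftrightarrow> a = 0 \<or> a = 1 \<or> a = 2 \<or> a = 3" for a :: nat
    by auto
  have b: "block cell i A = (\<lambda>(x, y). cell (x + y) (A + x)) `
      {(x, y). x < i \<and> y < 5 - i \<and> 0 < x + y}" for i
    by (auto simp: block_def)
  have "{(x, y). x < 1 \<and> y < 5 - 1 \<and> 0 < x + y} = {(0, 1), (0, 2), (0, 3::nat)}"
    "{(x, y). x < 2 \<and> y < 5 - 2 \<and> 0 < x + y} = {(0, 1), (0, 2), (1, 0), (1, 1), (1, 2::nat)}"
    "{(x, y). x < 3 \<and> y < 5 - 3 \<and> 0 < x + y} = {(0, 1), (1, 0), (1, 1), (2, 0), (2, 1::nat)}"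
    "{(x, y). x < 4 \<and> y < 5 - 4 \<and> 0 < x + y} = {(1, 0), (2, 0), (3::nat, 0::nat)}"
    by (auto simp: less)
  note c = this
  show "block cell 1 A = {cell 1 A, cell 2 A, cell 3 A}"
    unfolding b c by auto
  show "block cell 2 A = {cell 1 A, cell 1 (A + 1), cell 2 A, cell 2 (A + 1), cell 3 (A + 1)}"
    unfolding b c by (auto simp: numeral_eq_Suc)
  show "block cell 3 A = {cell 1 A, cell 1 (A + 1), cell 2 (A + 1), cell 2 (A + 2), cell 3 (A + 2)}"
    unfolding b c by (auto simp: numeral_eq_Suc)
  show "block cell 4 A = {cell 1 (A + 1), cell 2 (A + 2), cell 3 (A + 3)}"
    unfolding b c by (auto simp: numeral_eq_Suc)
qed

text \<open>Each of the three cells at \<open>A\<close> has a single colour, so its coefficient is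
  counted for at most one \<open>c\<close>.\<close>

lemma sum_weight_le: "finite C \<Longrightarrow> (\<Sum>c\<in>C. weight cell c A) \<le> 5"
proof -
  assume C: "finite C"
  have s: "(\<Sum>c\<in>C. of_bool (d = c)) \<le> (1::nat)" for d
    using C by (simp add: of_bool_def sum.delta)
  have "(\<Sum>c\<in>C. weight cell c A) = 2 * (\<Sum>c\<in>C. of_bool (cell 1 A = c)) +
      2 * (\<Sum>c\<in>C. of_bool (cell 2 A = c)) + (\<Sum>c\<in>C. of_bool (cell 3 A = c))"
    by (simp only: weight_def sum.distrib sum_distrib_left)
  then show ?thesis using s[of "cell 1 A"] s[of "cell 2 A"] s[of "cell 3 A"] by linarith
qed

lemma weight_le: "weight cell c A \<le> 5"
  by (simp add: weight_def)

text \<open>Double counting: every position of the run is charged to a cell of colour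
  \<open>c\<close> in its block, and a cell is charged at most as often as its coefficient in
  \<open>weight\<close>. Blocks reach at most 3 beyond their position, so the charged cells may lie
  in 3 further columns of weight at most 5 each; hence the 15.\<close>

lemma run_length_le:
  assumes "i \<in> {1, 2, 3, 4}" and "l \<le> u" and hit: "\<forall>A\<in>{l..<u}. c \<in> block cell i A"
  shows "u \<le> l + (\<Sum>A\<in>{l..<u}. weight cell c A) + 15"
proof -
  define g :: "nat \<Rightarrow> nat \<Rightarrow> nat" where "g s A = of_bool (cell s A = c)" for s A
  define \<Sigma> where "\<Sigma> s = (\<Sum>A\<in>{l..<u + 3}. g s A)" for s
  have sh: "(\<Sum>A\<in>{l..<u}. g s (A + x)) \<le> \<Sigma> s" if "x \<le> 3" for s x
    unfolding \<Sigma>_def using sum_shift_le[OF that] .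
  have sh0: "(\<Sum>A\<in>{l..<u}. g s A) \<le> \<Sigma> s" for s
    using sh[of 0] by simp
  have "u - l \<le> 2 * \<Sigma> 1 + 2 * \<Sigma> 2 + \<Sigma> 3"
  proof -
    have len: "u - l = (\<Sum>A\<in>{l..<u}. 1)" by simp
    consider "i = 1" | "i = 2" | "i = 3" | "i = 4" using assms(1) by auto
    then show ?thesis
    proof cases
      case 1
      have "u - l \<le> (\<Sum>A\<in>{l..<u}. g 1 A + g 2 A + g 3 A)"
        unfolding len using hit by (intro sum_mono) (auto simp: 1 block_1 g_def simp del: One_nat_def)
      then show ?thesis
        using sh0[of 1] sh0[of 2] sh0[of 3] by (simp add: sum.distrib)
    next
      case 2
      have "u - l \<le> (\<Sum>A\<in>{l..<u}. g 1 A + g 1 (A + 1) + g 2 A + g 2 (A + 1) + g 3 (A + 1))"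
        unfolding len using hit by (intro sum_mono) (auto simp: 2 block_2 g_def simp del: One_nat_def)
      then show ?thesis
        using sh0[of 1] sh[of 1 1] sh0[of 2] sh[of 1 2] sh[of 1 3] by (simp add: sum.distrib)
    next
      case 3
      have "u - l \<le> (\<Sum>A\<in>{l..<u}. g 1 A + g 1 (A + 1) + g 2 (A + 1) + g 2 (A + 2) + g 3 (A + 2))"
        unfolding len using hit by (intro sum_mono) (auto simp: 3 block_3 g_def simp del: One_nat_def)
      then show ?thesis
        using sh0[of 1] sh[of 1 1] sh[of 1 2] sh[of 2 2] sh[of 2 3] by (simp add: sum.distrib)
    next
      case 4
      have "u - l \<le> (\<Sum>A\<in>{l..<u}. g 1 (A + 1) + g 2 (A + 2) + g 3 (A + 3))"
        unfolding len using hit by (intro sum_mono) (auto simp: 4 block_4 g_def simp del: One_nat_def)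
      then show ?thesis
        using sh[of 1 1] sh[of 2 2] sh[of 3 3] by (simp add: sum.distrib)
    qed
  qed
  also have "\<dots> = (\<Sum>A\<in>{l..<u + 3}. weight cell c A)"
    by (simp only: \<Sigma>_def weight_def g_def sum.distrib sum_distrib_left)
  also have "\<dots> = (\<Sum>A\<in>{l..<u}. weight cell c A) + (\<Sum>A\<in>{u..<u + 3}. weight cell c A)"
    using assms(2) by (simp add: sum.atLeastLessThan_concat)
  also have "(\<Sum>A\<in>{u..<u + 3}. weight cell c A) \<le> 15"
    using sum_bounded_above[of "{u..<u + 3}" "weight cell c" 5] weight_le by simp
  finally show ?thesis by linarith
qed

text \<open>Greedy choice of the positions: each is the first one, not before the previous, whose block
  misses \<open>c\<close>. Since this must fail, \<open>{..<N}\<close> splits into four runs on each of which blocks of one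
  shape all contain \<open>c\<close>.\<close>
lemma colour_density:
  assumes "\<And>A1 A2 A3 A4. A1 \<le> A2 \<Longrightarrow> A2 \<le> A3 \<Longrightarrow> A3 \<le> A4 \<Longrightarrow> A4 < N \<Longrightarrow>
    c \<in> block cell 1 A1 \<union> block cell 2 A2 \<union> block cell 3 A3 \<union> block cell 4 A4"
  shows "N \<le> (\<Sum>A<N. weight cell c A) + 60"
proof -
  let ?P = "\<lambda>i A. c \<in> block cell i A" and ?w = "weight cell c"
  obtain a1 where a1: "0 \<le> a1" "a1 \<le> N" "\<forall>A\<in>{0..<a1}. ?P 1 A" "a1 = N \<or> \<not> ?P 1 a1"
    using maximal_run[of 0 N "?P 1"] by blast
  obtain a2 where a2: "a1 \<le> a2" "a2 \<le> N" "\<forall>A\<in>{a1..<a2}. ?P 2 A" "a2 = N \<or> \<not> ?P 2 a2"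
    using maximal_run[OF a1(2), of "?P 2"] by blast
  obtain a3 where a3: "a2 \<le> a3" "a3 \<le> N" "\<forall>A\<in>{a2..<a3}. ?P 3 A" "a3 = N \<or> \<not> ?P 3 a3"
    using maximal_run[OF a2(2), of "?P 3"] by blast
  obtain a4 where a4: "a3 \<le> a4" "a4 \<le> N" "\<forall>A\<in>{a3..<a4}. ?P 4 A" "a4 = N \<or> \<not> ?P 4 a4"
    using maximal_run[OF a3(2), of "?P 4"] by blast
  have "a4 = N"
  proof (rule ccontr)
    assume "a4 \<noteq> N"
    then have "a4 < N" "a3 < N" "a2 < N" "a1 < N" using a1 a2 a3 a4 by auto
    then show False using assms[of a1 a2 a3 a4] a1 a2 a3 a4 by auto
  qed
  \<comment> \<open>The four runs tile \<open>{..<N}\<close>, and their four errors of 15 add up to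
    60.\<close>
  have "(\<Sum>A<N. ?w A) = sum ?w {0..<a1} + sum ?w {a1..<a2} + sum ?w {a2..<a3} + sum ?w {a3..<N}"
    using a1 a2 a3 a4 \<open>a4 = N\<close> by (simp add: sum.atLeastLessThan_concat lessThan_atLeast0)
  moreover have "a1 \<le> 0 + sum ?w {0..<a1} + 15"
    using run_length_le[OF _ a1(1) a1(3)] by simp
  moreover have "a2 \<le> a1 + sum ?w {a1..<a2} + 15"
    using run_length_le[OF _ a2(1) a2(3)] by simp
  moreover have "a3 \<le> a2 + sum ?w {a2..<a3} + 15"
    using run_length_le[OF _ a3(1) a3(3)] by simp
  moreover have "a4 \<le> a3 + sum ?w {a3..<a4} + 15"
    using run_length_le[OF _ a4(1) a4(3)] by simp
  ultimately show ?thesis unfolding \<open>a4 = N\<close> by linarith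
qed

section \<open>From punctured subcubes to blocks, and the final count\<close>

lemma cell_in_block:
  assumes D: "D \<subseteq> {..<W + 4}" "card D = 4" and B: "B = {..<W + 4} - D"
    and q: "q \<in> D" and X: "X \<subseteq> D - {q}" "X \<noteq> {}"
  shows "\<chi> (card (B \<union> X)) (rank (B \<union> X) q) \<in> block (\<lambda>s. \<chi> (W + s)) (Suc (rank D q)) (q - rank D q)"
proof -
  have "finite D" using D(1) by (rule finite_subset) simp
  then have fin: "finite D" "finite B" "finite X" "finite (D - {q})"
    using B finite_subset[OF X(1)] by simp_all
  have BX: "B \<inter> X = {}" using B X by auto
  have "card B = W" using D B fin by (simp add: card_Diff_subset)
  then have card: "card (B \<union> X) = W + card X" using card_Un_disjoint[OF fin(2,3) BX] by simp
  have "q < W + 4" using D(1) q by (auto dest!: subsetD)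
  then have "B \<inter> {..<q} = {..<q} - D \<inter> {..<q}" unfolding B by auto
  \<comment> \<open>All coordinates outside \<open>D\<close> carry ones, so the base ones left of
    \<open>q\<close> are all smaller coordinates except those in \<open>D\<close>. This number is
    the position of the block.\<close>
  then have "rank B q = q - rank D q" unfolding rank_def using fin by (simp add: card_Diff_subset)
  then have rank: "rank (B \<union> X) q = (q - rank D q) + rank X q"
    using rank_Un[OF fin(2,3) BX] by simp
  define y where "y = card (X \<inter> {q<..})"
  have "q \<notin> X" using X by auto
  then have cX: "card X = rank X q + y"
    unfolding y_def using card_split_at[OF fin(3)] by simp
  have "card (D - {q}) = rank (D - {q}) q + card ((D - {q}) \<inter> {q<..})"
    by (rule card_split_at[OF fin(4)]) simp
  moreover have "rank (D - {q}) q = rank D q" unfolding rank_def by (rule arg_cong[of _ _ card]) auto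
  moreover have "y \<le> card ((D - {q}) \<inter> {q<..})"
    unfolding y_def using fin X by (intro card_mono) auto
  moreover have "card (D - {q}) = 3" using D q fin by simp
  moreover have "rank X q \<le> rank D q"
    unfolding rank_def using fin X by (intro card_mono) auto
  \<comment> \<open>The free ones of \<open>X\<close> left and right of \<open>q\<close> are the two
    coordinates in the rectangle. They are not both zero because \<open>X\<close> is nonempty, which
    reflects the puncture at the bottom.\<close>
  ultimately have "rank X q < Suc (rank D q)" "y < 5 - Suc (rank D q)" by linarith+
  moreover have "0 < rank X q + y" using cX X(2) fin(3) card_gt_0_iff by metis
  ultimately show ?thesis
    unfolding block_def card rank cX mem_Collect_eq
    by (intro exI[of _ "rank X q"] exI[of _ y] conjI) (simp_all only: add.assoc)
qed

lemma not_polychromatic_colorable: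
  assumes v: "length v = 4" and "6 \<le> r"
  shows "\<not> polychromatic_colorable (delete_vertex (hypercube 4) v) r"
proof
  let ?G = "delete_vertex (hypercube 4) v"
  assume colorable: "polychromatic_colorable ?G r"
  \<comment> \<open>Summing over six colours will give
    \<open>6 * (W + 1) \<le> 5 * (W + 1) + 6 * 60\<close>; 360 is the least \<open>W\<close> that
    violates this.\<close>
  define W :: nat where "W = 360"
  from simple_subcolouring[of r "W + 4"] obtain n where n: "\<And>col :: nat set \<Rightarrow> nat \<Rightarrow> nat.
    (\<And>X q. X \<subseteq> {..<n} \<Longrightarrow> q < n \<Longrightarrow> q \<notin> X \<Longrightarrow> col X q < r) \<Longrightarrow>
    \<exists>e \<chi>. strict_mono_on {..<W + 4} e \<and> e ` {..<W + 4} \<subseteq> {..<n} \<and>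
      (\<forall>X q. X \<subseteq> {..<W + 4} \<longrightarrow> q < W + 4 \<longrightarrow> q \<notin> X \<longrightarrow>
        col (e ` X) (e q) = \<chi> (card X) (rank X q))"
    by metis
  \<comment> \<open>Applying the Ramsey statement to a constant colouring shows that
    \<open>n\<close> is at least \<open>W + 4\<close>, so the punctured cube does embed in the
    hypercube of dimension \<open>n\<close>.\<close>
  obtain e0 :: "nat \<Rightarrow> nat" where e0: "strict_mono_on {..<W + 4} e0" "e0 ` {..<W + 4} \<subseteq> {..<n}"
    using n[of "\<lambda>X q. 0"] assms(2) by auto
  have "inj_on e0 {..<W + 4}" using e0(1) by (rule strict_mono_on_imp_inj_on)
  then have "W + 4 \<le> n" using e0(2) card_inj_on_le[of e0 "{..<W + 4}" "{..<n}"] by simp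
  then have n4: "4 \<le> n" by simp
  then have "{..<4} \<subseteq> {..<n}" by simp
  then have "\<exists>H. embedding ?G n H"
    by (rule punctured_subcube_embedding[OF v empty_subsetI]) auto
  then obtain c where c: "polychromatic_coloring ?G r n c"
    using colorable le_trans[OF one_le_numeral n4] unfolding polychromatic_colorable_def by blast
  have "c (cube_edge n X q) < r" if "X \<subseteq> {..<n}" "q < n" "q \<notin> X" for X q
  proof -
    have "cube_edge n X q \<in> edges (hypercube n)" unfolding edges_hypercube using that by blast
    then show ?thesis using c unfolding polychromatic_coloring_def by blast
  qed
  from n[of "\<lambda>X q. c (cube_edge n X q)", OF this] obtain e \<chi> where
    e: "strict_mono_on {..<W + 4} e" "e ` {..<W + 4} \<subseteq> {..<n}"
    and \<chi>: "\<And>X q. X \<subseteq> {..<W + 4} \<Longrightarrow> q < W + 4 \<Longrightarrow> q \<notin> X \<Longrightarrow>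
        c (cube_edge n (e ` X) (e q)) = \<chi> (card X) (rank X q)"
    by blast
  have e_inj: "inj_on e {..<W + 4}" using e(1) by (rule strict_mono_on_imp_inj_on)
  define cell where "cell s = \<chi> (W + s)" for s
  have hit: "k \<in> block cell 1 A1 \<union> block cell 2 A2 \<union> block cell 3 A3 \<union> block cell 4 A4"
    if k: "k < 6" and A: "A1 \<le> A2" "A2 \<le> A3" "A3 \<le> A4" "A4 < W + 1" for k A1 A2 A3 A4
  proof -
    \<comment> \<open>With ones everywhere outside \<open>D\<close>, the base ones left of the four
      directions number exactly \<open>A1\<close>, \<open>A2\<close>, \<open>A3\<close>,
      \<open>A4\<close>. The offsets 0 to 3 turn nondecreasing positions into strictly increasing
      coordinates.\<close>
    define D where "D = {A1, A2 + 1, A3 + 2, A4 + 3}"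
    define B where "B = {..<W + 4} - D"
    have D: "D \<subseteq> {..<W + 4}" "card D = 4" using A by (auto simp: D_def)
    have B: "B \<subseteq> {..<W + 4}" "B \<inter> D = {}" by (auto simp: B_def)
    have "e ` B \<subseteq> {..<n}" "e ` D \<subseteq> {..<n}" "card (e ` D) = 4" "e ` B \<inter> e ` D = {}"
    proof -
      show "e ` B \<subseteq> {..<n}" "e ` D \<subseteq> {..<n}" using e(2) B D by (meson image_mono subset_trans)+
      show "card (e ` D) = 4" using card_image[OF inj_on_subset[OF e_inj D(1)]] D by simp
      show "e ` B \<inter> e ` D = {}" using inj_on_image_Int[OF e_inj B(1) D(1)] B(2) by simp
    qed
    from punctured_subcube_embedding[OF v this] obtain H where H: "embedding ?G n H"
      and edges: "\<And>f. f \<in> edges H \<Longrightarrow>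
        \<exists>q\<in>e ` D. \<exists>X\<subseteq>e ` D - {q}. X \<noteq> {} \<and> f = cube_edge n (e ` B \<union> X) q"
      by metis
    have "k < r" using k assms(2) by simp
    then obtain f where f: "f \<in> edges H" "c f = k"
      using c H unfolding polychromatic_coloring_def by blast
    from edges[OF f(1)] obtain q Y where q: "q \<in> D" and Y: "Y \<subseteq> e ` D - {e q}" "Y \<noteq> {}"
      "f = cube_edge n (e ` B \<union> Y) (e q)"
      by blast
    define X where "X = {x \<in> D. e x \<in> Y}"
    have eX: "e ` X = Y" using Y(1) by (auto simp: X_def)
    have X: "X \<subseteq> D - {q}" "X \<noteq> {}" using Y eX by (auto simp: X_def)
    have "c f = \<chi> (card (B \<union> X)) (rank (B \<union> X) q)"
    proof -
      have "f = cube_edge n (e ` (B \<union> X)) (e q)" using Y(3) eX by (simp add: image_Un)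
      moreover have "B \<union> X \<subseteq> {..<W + 4}" "q < W + 4" "q \<notin> B \<union> X"
        using B D q X by auto
      ultimately show ?thesis using \<chi> by simp
    qed
    also have "\<dots> \<in> block cell (Suc (rank D q)) (q - rank D q)"
      unfolding cell_def by (rule cell_in_block[OF D B_def q X])
    finally have k_in: "k \<in> block cell (Suc (rank D q)) (q - rank D q)" using f(2) by simp
    have ranks: "rank D A1 = 0" "rank D (A2 + 1) = 1" "rank D (A3 + 2) = 2" "rank D (A4 + 3) = 3"
      using A by (simp_all add: rank_def D_def)
    consider "q = A1" | "q = A2 + 1" | "q = A3 + 2" | "q = A4 + 3" using q by (auto simp: D_def)
    then show ?thesis
    proof cases
      case 1
      with k_in show ?thesis unfolding 1 ranks by simp
    next
      case 2
      with k_in show ?thesis unfolding 2 ranks by (simp add: numeral_2_eq_2)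
    next
      case 3
      with k_in show ?thesis unfolding 3 ranks by (simp add: eval_nat_numeral)
    next
      case 4
      with k_in show ?thesis unfolding 4 ranks by (simp add: eval_nat_numeral)
    qed
  qed
  have "W + 1 \<le> (\<Sum>A<W + 1. weight cell k A) + 60" if "k < 6" for k
    by (rule colour_density) (rule hit[OF that])
  then have "(\<Sum>k<6::nat. W + 1) \<le> (\<Sum>k<6. (\<Sum>A<W + 1. weight cell k A) + 60)"
    by (intro sum_mono) auto
  \<comment> \<open>After exchanging the sums, the six colours share a total weight of at most 5 at
    each position.\<close>
  also have "\<dots> = (\<Sum>A<W + 1. \<Sum>k<6. weight cell k A) + 360"
    unfolding sum.distrib by (subst sum.swap) simp
  also have "(\<Sum>A<W + 1. \<Sum>k<6. weight cell k A) \<le> (\<Sum>A<W + 1. 5)"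
    by (intro sum_mono sum_weight_le) simp
  finally show False by (simp add: W_def)
qed

theorem theorem11:
  fixes v :: "bool list"
  assumes "v \<in> verts (hypercube 4)"
  shows "polychromatic_number (delete_vertex (hypercube 4) v) = 5"
proof -
  have v: "length v = 4" using assms by (simp add: hypercube_def)
  show ?thesis
    unfolding polychromatic_number_def
  proof (rule Greatest_equality)
    show "polychromatic_colorable (delete_vertex (hypercube 4) v) 5"
      by (rule polychromatic_colorable_5[OF v])
    show "r \<le> 5" if "polychromatic_colorable (delete_vertex (hypercube 4) v) r" for r
      using not_polychromatic_colorable[OF v, of r] that by linarith
  qed
qed

end
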